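(* Assume the standing setting and assumption in the context. There exist constants $C_7,C_8,C_9,C_3'>0$ such that for any Borel set $B\subset\mathbb R$ with $\mu(B)>0$ there exists $N\in\mathbb N$ such that for all $s>C_7$, $$\mathbb P\Big(\sup_{x\in\mathbb Z^d:\,|x|_1\ge N}\ \max_{\pi\in\mathrm{Geo}(0,x)}\nu^\pi(B) > s\,\mu(B)^{1/d}\Big)\ \le\ C_8 e^{-C_9 s}.$$ Moreover, $$\mathbb E\Big[\sup_{x\in\mathbb Z^d:\,|x|_1\ge N}\ \max_{\pi\in\mathrm{Geo}(0,x)}\nu^\pi(B)\Big]\ \le\ C_3'\,\mu(B)^{1/d}.$$
   Context: Setting: $d\ge2$; $\mathcal E^d$ nearest-neighbor edges of $\mathbb Z^d$; $\{\tau_e\}$ i.i.d. non-negative with law $\mu$, distribution function $F$, essential infimum $r$. Standing assumption: $F(r)<p_c(d)$ if $r=0$ and $F(r)<\vec p_c(d)$ if $r>0$ ($p_c(d)$, $\vec p_c(d)$: critical probabilities of Bernoulli bond and oriented bond percolation on $\mathbb Z^d$). $T(\gamma)=\sum_{e\in\gamma}\tau_e$; $T(x,y)$ is the infimum over vertex self-avoiding paths from $x$ to $y$; a geodesic attains it; $\mathrm{Geo}(0,x)$ is the set of geodesics from $0$ to $x$. For a geodesic $\pi$ with $|\pi|$ edges, $\nu^\pi(B)=\frac1{|\pi|}\#\{e\in\pi:\tau_e\in B\}$. *)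

theory Defs
  imports "HOL-Probability.Probability"
begin

text \<open>Vertices of Z^d are functions nat => int vanishing at coordinates i >= d.
  Edges are two-element sets of nearest neighbours.\<close>

type_synonym vtx = "nat \<Rightarrow> int"
type_synonym edge = "vtx set"

definition lattice :: "nat \<Rightarrow> vtx set" where
  "lattice d = {x. \<forall>i\<ge>d. x i = 0}"

definition l1 :: "nat \<Rightarrow> vtx \<Rightarrow> int" where
  "l1 d x = (\<Sum>i<d. \<bar>x i\<bar>)"

definition origin :: vtx where
  "origin = (\<lambda>_. 0)"

definition nn :: "nat \<Rightarrow> vtx \<Rightarrow> vtx \<Rightarrow> bool" where
  "nn d x y \<longleftrightarrow> x \<in> lattice d \<and> y \<in> lattice d \<and> l1 d (\<lambda>i. x i - y i) = 1"

definition edges :: "nat \<Rightarrow> edge set" where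
  "edges d = {{x, y} | x y. nn d x y}"

definition is_path :: "nat \<Rightarrow> vtx list \<Rightarrow> bool" where
  "is_path d p \<longleftrightarrow> p \<noteq> [] \<and> distinct p \<and> set p \<subseteq> lattice d \<and>
     (\<forall>i. Suc i < length p \<longrightarrow> nn d (p ! i) (p ! Suc i))"

definition paths :: "nat \<Rightarrow> vtx \<Rightarrow> vtx \<Rightarrow> vtx list set" where
  "paths d x y = {p. is_path d p \<and> hd p = x \<and> last p = y}"

definition path_T :: "(edge \<Rightarrow> real) \<Rightarrow> vtx list \<Rightarrow> real" where
  "path_T t p = (\<Sum>i<length p - 1. t {p ! i, p ! Suc i})"

definition passage_time :: "nat \<Rightarrow> (edge \<Rightarrow> real) \<Rightarrow> vtx \<Rightarrow> vtx \<Rightarrow> real" where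
  "passage_time d t x y = Inf (path_T t ` paths d x y)"

definition geodesics :: "nat \<Rightarrow> (edge \<Rightarrow> real) \<Rightarrow> vtx \<Rightarrow> vtx \<Rightarrow> vtx list set" where
  "geodesics d t x y = {p \<in> paths d x y. path_T t p = passage_time d t x y}"

definition emp :: "(edge \<Rightarrow> real) \<Rightarrow> vtx list \<Rightarrow> real set \<Rightarrow> real" where
  "emp t p B = real (card {i. Suc i < length p \<and> t {p ! i, p ! Suc i} \<in> B}) / real (length p - 1)"

definition Zsup :: "nat \<Rightarrow> (edge \<Rightarrow> real) \<Rightarrow> nat \<Rightarrow> real set \<Rightarrow> ereal" where
  "Zsup d t N B = (SUP x\<in>{x \<in> lattice d. int N \<le> l1 d x}.
                     SUP p\<in>geodesics d t origin x. ereal (emp t p B))"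

definition bern :: "nat \<Rightarrow> real \<Rightarrow> (edge \<Rightarrow> bool) measure" where
  "bern d p = PiM (edges d) (\<lambda>_. measure_pmf (bernoulli_pmf p))"

definition open_cluster :: "nat \<Rightarrow> (edge \<Rightarrow> bool) \<Rightarrow> vtx set" where
  "open_cluster d \<omega> = {y. \<exists>p\<in>paths d origin y.
       \<forall>i. Suc i < length p \<longrightarrow> \<omega> {p ! i, p ! Suc i}}"

definition theta :: "nat \<Rightarrow> real \<Rightarrow> real" where
  "theta d p = measure (bern d p) {\<omega> \<in> space (bern d p). infinite (open_cluster d \<omega>)}"

definition p_c :: "nat \<Rightarrow> real" where
  "p_c d = Sup {p \<in> {0..1}. theta d p = 0}"

definition ostep :: "nat \<Rightarrow> vtx \<Rightarrow> vtx \<Rightarrow> bool" where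
  "ostep d x y \<longleftrightarrow> x \<in> lattice d \<and> (\<exists>i<d. y = x(i := x i + 1))"

definition oriented_cluster :: "nat \<Rightarrow> (edge \<Rightarrow> bool) \<Rightarrow> vtx set" where
  "oriented_cluster d \<omega> = {y. \<exists>p. p \<noteq> [] \<and> hd p = origin \<and> last p = y \<and>
       (\<forall>i. Suc i < length p \<longrightarrow> ostep d (p ! i) (p ! Suc i) \<and> \<omega> {p ! i, p ! Suc i})}"

definition otheta :: "nat \<Rightarrow> real \<Rightarrow> real" where
  "otheta d p = measure (bern d p) {\<omega> \<in> space (bern d p). infinite (oriented_cluster d \<omega>)}"

definition vp_c :: "nat \<Rightarrow> real" where
  "vp_c d = Sup {p \<in> {0..1}. otheta d p = 0}"

definition ess_inf_law :: "real measure \<Rightarrow> real" where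
  "ess_inf_law \<mu> = Sup {t. measure \<mu> {..<t} = 0}"

definition cdf :: "real measure \<Rightarrow> real \<Rightarrow> real" where
  "cdf \<mu> t = measure \<mu> {..t}"

end

theory Submission
  imports Defs
begin

text \<open>
  The bound holds for all self-avoiding paths from the origin, geodesic or not. Put
  \<open>p = \<mu> B\<close> and \<open>q = p powr (1/d)\<close>, and cut \<open>\<int>\<^sup>d\<close> into cubes of side \<open>l \<approx> 1/q\<close>, so that a cube
  contains \<open>O(1)\<close> edges with weight in \<open>B\<close> on average. Recording the cube of every \<open>l\<close>-th vertex,
  a path with \<open>n\<close> edges is covered by the neighbourhoods of at most \<open>n q + 1\<close> successively adjacent
  cubes, and there are at most \<open>3^(d n q)\<close> such cube sequences. A Chernoff bound for the number of
  \<open>B\<close>-edges in one such cover, a union bound over the sequences and summation over \<open>n \<ge> N\<close> give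
  the exponential tail; \<open>N\<close> of order \<open>1/q\<close>, up to a logarithm, makes the constants independent
  of \<open>B\<close>.
\<close>

section \<open>Boxes, incident edges and coarse regions\<close>

text \<open>The default value 0 of \<open>PiE_dflt\<close> outside the first \<open>d\<close>
  coordinates makes the members lattice points, so that the box is a finite product whose
  cardinality is immediate. With corner -1 and side 3 it is \<open>{-1,0,1}^d\<close>, which serves
  below both for edge directions and for the steps between adjacent cubes.\<close>

definition lattice_box :: "nat \<Rightarrow> vtx \<Rightarrow> nat \<Rightarrow> vtx set" where
  "lattice_box d a L = PiE_dflt {..<d} 0 (\<lambda>i. {a i..<a i + int L})"

definition incident :: "nat \<Rightarrow> vtx set \<Rightarrow> edge set" where
  "incident d W = {e \<in> edges d. e \<inter> W \<noteq> {}}"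

text \<open>
  The list \<open>zs\<close> holds the increments of a walk of cubes of side \<open>l\<close> starting at the cube at the origin;
  the region is the union of these cubes, each enlarged by \<open>l\<close> on all sides.
\<close>

definition coarse_region :: "nat \<Rightarrow> nat \<Rightarrow> vtx list \<Rightarrow> vtx set" where
  "coarse_region d l zs =
     (\<Union>k\<le>length zs. lattice_box d (\<lambda>i. int l * (\<Sum>j<k. (zs ! j) i) - int l) (3 * l))"

lemma finite_lattice_box: "finite (lattice_box d a L)"
  unfolding lattice_box_def by (rule finite_PiE_dflt) auto

lemma card_lattice_box: "card (lattice_box d a L) = L ^ d"
  unfolding lattice_box_def by (subst card_PiE_dflt) auto

lemma mem_lattice_box_iff:
  "x \<in> lattice_box d a L \<longleftrightarrow> x \<in> lattice d \<and> (\<forall>i<d. a i \<le> x i \<and> x i < a i + int L)"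
  by (auto simp: lattice_box_def PiE_dflt_def lattice_def not_less)

lemma abs_coord_le_l1:
  assumes "i < d"
  shows "\<bar>x i\<bar> \<le> l1 d x"
  unfolding l1_def using assms by (intro member_le_sum) auto

text \<open>Every edge meeting \<open>W\<close> has the form \<open>{x, x + z}\<close> with
  \<open>x\<close> in \<open>W\<close> and \<open>z\<close> in \<open>{-1,0,1}^d\<close>. The crude
  factor \<open>3 ^ d\<close> suffices, since only constants depending on \<open>d\<close> are
  affected.\<close>

lemma
  assumes "finite W"
  shows finite_incident: "finite (incident d W)"
    and card_incident_le: "card (incident d W) \<le> card W * 3 ^ d"
proof -
  let ?f = "\<lambda>(x :: vtx, z :: vtx). {x, (\<lambda>i. x i + z i)}"
  let ?S = "W \<times> lattice_box d (\<lambda>_. -1) 3"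
  have fin: "finite ?S"
    using assms finite_lattice_box by blast
  have sub: "incident d W \<subseteq> ?f ` ?S"
  proof
    fix e assume "e \<in> incident d W"
    then obtain u v where e: "e = {u, v}" "nn d u v" "u \<in> W \<or> v \<in> W"
      by (auto simp: incident_def edges_def)
    have sym: "nn d v u"
      using e(2) by (auto simp: nn_def l1_def abs_minus_commute)
    have *: "{x, y} \<in> ?f ` ?S" if "nn d x y" "x \<in> W" for x y
    proof -
      have "\<bar>x i - y i\<bar> \<le> 1" if "i < d" for i
        using abs_coord_le_l1[OF that, of "\<lambda>i. x i - y i"] \<open>nn d x y\<close> by (simp add: nn_def)
      then have "(\<lambda>i. y i - x i) \<in> lattice_box d (\<lambda>_. -1) 3"
        using \<open>nn d x y\<close> by (fastforce simp: mem_lattice_box_iff nn_def lattice_def)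
      then show ?thesis
        using \<open>x \<in> W\<close> by (intro image_eqI[of _ _ "(x, \<lambda>i. y i - x i)"]) auto
    qed
    show "e \<in> ?f ` ?S"
      using e *[OF e(2)] *[OF sym] by (auto simp: insert_commute)
  qed
  show "finite (incident d W)"
    using sub fin by (meson finite_imageI finite_subset)
  have "card (incident d W) \<le> card ?S"
    using surj_card_le[OF fin sub] .
  then show "card (incident d W) \<le> card W * 3 ^ d"
    by (simp add: card_cartesian_product card_lattice_box)
qed

lemma finite_coarse_region: "finite (coarse_region d l zs)"
  unfolding coarse_region_def using finite_lattice_box by blast

lemma card_coarse_region_le: "card (coarse_region d l zs) \<le> (length zs + 1) * (3 * l) ^ d"
proof -
  have "card (coarse_region d l zs) \<le> (\<Sum>k\<le>length zs. (3 * l) ^ d)"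
    unfolding coarse_region_def
    by (rule order_trans[OF card_UN_le]) (auto simp: card_lattice_box)
  then show ?thesis by simp
qed

section \<open>Paths and their covers by coarse regions\<close>

lemma l1_path_diff_le:
  assumes "is_path d p" "i \<le> j" "j < length p"
  shows "l1 d (\<lambda>c. (p ! j) c - (p ! i) c) \<le> int (j - i)"
  using assms(2,3)
proof (induction j rule: dec_induct)
  case base
  then show ?case by (simp add: l1_def)
next
  case (step j)
  have nn: "nn d (p ! j) (p ! Suc j)"
    using assms(1) step.prems by (auto simp: is_path_def)
  have "l1 d (\<lambda>c. (p ! Suc j) c - (p ! i) c)
      \<le> l1 d (\<lambda>c. (p ! j) c - (p ! Suc j) c) + l1 d (\<lambda>c. (p ! j) c - (p ! i) c)"
    unfolding l1_def sum.distrib[symmetric] by (rule sum_mono) linarith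
  also have "\<dots> \<le> 1 + int (j - i)"
    using nn step by (auto simp: nn_def)
  finally show ?case
    using step.hyps by linarith
qed

lemma path_coord_diff_le:
  assumes "is_path d p" "i \<le> j" "j < length p" "c < d"
  shows "\<bar>(p ! j) c - (p ! i) c\<bar> \<le> int (j - i)"
  using abs_coord_le_l1[OF assms(4)] l1_path_diff_le[OF assms(1-3)] order_trans by fast

lemma l1_le_path_length:
  assumes "p \<in> paths d origin x"
  shows "l1 d x \<le> int (length p - 1)"
proof -
  have p: "is_path d p" "p \<noteq> []" "p ! 0 = origin" "p ! (length p - 1) = x"
    using assms by (auto simp: paths_def is_path_def hd_conv_nth last_conv_nth)
  from p(2) have "length p - 1 < length p" by simp
  from l1_path_diff_le[OF p(1) _ this, of 0] p(3,4) show ?thesis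
    by (simp add: origin_def)
qed

text \<open>Applied coordinatewise, this makes the cubes of two vertices at most \<open>l\<close>
  path steps apart equal or adjacent, diagonal adjacency included.\<close>

lemma div_diff_le_1:
  fixes x y l :: int
  assumes "\<bar>x - y\<bar> \<le> l" "0 < l"
  shows "\<bar>x div l - y div l\<bar> \<le> 1"
proof -
  have "x div l \<le> (y + l) div l" "y div l \<le> (x + l) div l"
    using assms by (intro zdiv_mono1; linarith)+
  then show ?thesis using assms by simp
qed

text \<open>Every \<open>l\<close>-th vertex is sampled and replaced by the index of its cube.
  Consecutive samples lie in equal or adjacent cubes, and any other vertex is fewer than
  \<open>l\<close> steps past the latest sample, hence inside the enlarged cube of that
  sample.\<close>

lemma path_subset_coarse_region:
  assumes p: "is_path d p" "hd p = origin" and l: "0 < l"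
  obtains zs where "set zs \<subseteq> lattice_box d (\<lambda>_. -1) 3" "length zs = (length p - 1) div l"
    "set p \<subseteq> coarse_region d l zs"
proof
  \<comment> \<open>Integer \<open>div\<close> rounds down for negative coordinates too, so the
    cubes of side \<open>l\<close> tile the lattice.\<close>
  define u where "u k i = (p ! (k * l)) i div int l" for k i
  define r where "r = (length p - 1) div l"
  define zs where "zs = map (\<lambda>k i. u (Suc k) i - u k i) [0..<r]"
  have lat: "x \<in> lattice d" if "x \<in> set p" for x
    using p that by (auto simp: is_path_def)
  have ne: "p \<noteq> []" "p ! 0 = origin"
    using p by (auto simp: is_path_def hd_conv_nth)
  have lt: "k * l < length p" if "k \<le> r" for k
  proof -
    have "k * l \<le> r * l" using that by simp
    also have "\<dots> \<le> length p - 1" by (simp add: r_def)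
    also have "\<dots> < length p" using ne by simp
    finally show ?thesis .
  qed
  show len: "length zs = (length p - 1) div l"
    by (simp add: zs_def r_def)
  show "set zs \<subseteq> lattice_box d (\<lambda>_. -1) 3"
  proof
    fix z assume "z \<in> set zs"
    then obtain k where k: "k < r" "z = (\<lambda>i. u (Suc k) i - u k i)"
      by (auto simp: zs_def)
    have lat2: "p ! (k * l) \<in> lattice d" "p ! (Suc k * l) \<in> lattice d"
      using lt[of k] lt[of "Suc k"] k(1) by (auto intro!: lat nth_mem)
    have "\<bar>z i\<bar> \<le> 1" if "i < d" for i
      using path_coord_diff_le[OF p(1) _ lt[of "Suc k"] that, of "k * l"] k l
      by (auto simp: u_def intro!: div_diff_le_1)
    then show "z \<in> lattice_box d (\<lambda>_. -1) 3"
      using lat2 by (fastforce simp: mem_lattice_box_iff lattice_def k(2) u_def)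
  qed
  \<comment> \<open>The increments telescope, and \<open>u 0\<close> vanishes because the path
    starts at the origin; the increments alone therefore determine the cubes.\<close>
  have u_eq: "(\<Sum>j<k. (zs ! j) i) = u k i" if "k \<le> r" for k i
  proof -
    have "(\<Sum>j<k. (zs ! j) i) = (\<Sum>j<k. u (Suc j) i - u j i)"
      using that by (intro sum.cong) (auto simp: zs_def)
    also have "\<dots> = u k i - u 0 i"
      by (rule sum_lessThan_telescope)
    finally show ?thesis
      using ne by (simp add: u_def origin_def)
  qed
  show "set p \<subseteq> coarse_region d l zs"
  proof
    fix x assume "x \<in> set p"
    then obtain j where j: "j < length p" "x = p ! j"
      by (auto simp: in_set_conv_nth)
    define k where "k = j div l"
    \<comment> \<open>The last, possibly incomplete, block has index \<open>r\<close>; this is why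
      the region is a union of \<open>r + 1\<close> boxes.\<close>
    have k: "k \<le> r"
      using j(1) unfolding k_def r_def by (intro div_le_mono) auto
    have jk: "k * l \<le> j" "j - k * l < l"
      using l by (auto simp: k_def minus_div_mult_eq_mod)
    have "int l * u k i - int l \<le> x i \<and> x i < int l * u k i - int l + int (3 * l)"
      if "i < d" for i
    proof -
      have "\<bar>x i - (p ! (k * l)) i\<bar> < int l"
        using path_coord_diff_le[OF p(1) jk(1) j(1) that] jk(2) j(2) by simp
      moreover have "int l * u k i + (p ! (k * l)) i mod int l = (p ! (k * l)) i"
        by (simp add: u_def)
      moreover have "0 \<le> (p ! (k * l)) i mod int l" "(p ! (k * l)) i mod int l < int l"
        using l by auto
      ultimately show ?thesis by linarith
    qed
    then have "x \<in> lattice_box d (\<lambda>i. int l * (\<Sum>j<k. (zs ! j) i) - int l) (3 * l)"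
      using lat \<open>x \<in> set p\<close> by (simp add: mem_lattice_box_iff u_eq[OF k])
    then show "x \<in> coarse_region d l zs"
      using k by (auto simp: coarse_region_def len r_def)
  qed
qed

lemma path_edge_in_edges:
  assumes "is_path d p" "Suc i < length p"
  shows "{p ! i, p ! Suc i} \<in> edges d"
  using assms by (auto simp: is_path_def edges_def)

text \<open>Two indices giving the same edge with opposite orientations would need
  \<open>i = Suc j\<close> and \<open>j = Suc i\<close>. Injectivity lets hits counted along a path
  be compared with hits counted over a set of edges, where each edge counts once.\<close>

lemma inj_on_path_edges:
  assumes "is_path d p"
  shows "inj_on (\<lambda>i. {p ! i, p ! Suc i}) {i. Suc i < length p}"
proof (rule inj_onI)
  fix i j
  assume ij: "i \<in> {i. Suc i < length p}" "j \<in> {i. Suc i < length p}"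
    and eq: "{p ! i, p ! Suc i} = {p ! j, p ! Suc j}"
  have "distinct p" using assms by (simp add: is_path_def)
  then show "i = j"
    using ij eq by (auto simp: doubleton_eq_iff nth_eq_iff_index_eq)
qed

lemma card_path_hits_le:
  assumes "is_path d p" "set p \<subseteq> W" "finite W"
  shows "card {i. Suc i < length p \<and> t {p ! i, p ! Suc i} \<in> B} \<le> card {e \<in> incident d W. t e \<in> B}"
proof (rule card_inj_on_le)
  show "inj_on (\<lambda>i. {p ! i, p ! Suc i}) {i. Suc i < length p \<and> t {p ! i, p ! Suc i} \<in> B}"
    using inj_on_path_edges[OF assms(1)] by (rule inj_on_subset) auto
  show "(\<lambda>i. {p ! i, p ! Suc i}) ` {i. Suc i < length p \<and> t {p ! i, p ! Suc i} \<in> B}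
      \<subseteq> {e \<in> incident d W. t e \<in> B}"
    using assms(2) path_edge_in_edges[OF assms(1)] by (fastforce simp: incident_def)
  show "finite {e \<in> incident d W. t e \<in> B}"
    using finite_incident[OF assms(3)] by simp
qed

lemma card_path_hits_le_length:
  "card {i. Suc i < length p \<and> t {p ! i, p ! Suc i} \<in> B} \<le> length p - 1"
proof -
  have "{i. Suc i < length p \<and> t {p ! i, p ! Suc i} \<in> B} \<subseteq> {..<length p - 1}"
    by auto
  from card_mono[OF _ this] show ?thesis by simp
qed

section \<open>Boundedness and measurability of the supremum\<close>

lemma emp_le_1: "emp t p B \<le> 1"
  unfolding emp_def using card_path_hits_le_length[of p t B]
  \<comment> \<open>For a one-vertex path the quotient is 0 by the convention for division by
    zero.\<close>
  by (cases "length p - 1 = 0") (auto simp: divide_le_eq_1)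

lemma Zsup_le_1: "Zsup d t N B \<le> 1"
  unfolding Zsup_def by (intro SUP_least) (simp add: emp_le_1 flip: one_ereal_def)

lemma countable_lattice: "countable (lattice d)"
proof (rule countableI')
  show "inj_on (\<lambda>x. to_nat (map x [0..<d])) (lattice d)"
  proof (rule inj_onI)
    fix x y :: vtx
    assume xy: "x \<in> lattice d" "y \<in> lattice d"
      and "to_nat (map x [0..<d]) = to_nat (map y [0..<d])"
    then have eq: "x i = y i" if "i < d" for i using that by auto
    show "x = y"
    proof
      fix i show "x i = y i"
        using xy eq by (cases "i < d") (auto simp: lattice_def)
    qed
  qed
qed

lemma countable_paths: "countable (paths d x y)"
proof (rule countable_subset)
  show "paths d x y \<subseteq> lists (lattice d)"
    by (auto simp: paths_def is_path_def)
qed (simp add: countable_lattice)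

lemma measurable_Zsup:
  assumes [measurable]: "\<And>e. e \<in> edges d \<Longrightarrow> \<tau> e \<in> borel_measurable M"
    and B [measurable]: "B \<in> sets borel"
  shows "(\<lambda>\<omega>. Zsup d (\<lambda>e. \<tau> e \<omega>) N B) \<in> borel_measurable M"
proof -
  have T [measurable]: "(\<lambda>\<omega>. path_T (\<lambda>e. \<tau> e \<omega>) p) \<in> borel_measurable M" if "p \<in> paths d x y" for p x y
    unfolding path_T_def using that
    by (intro borel_measurable_sum assms path_edge_in_edges) (auto simp: paths_def)
  have [measurable]: "(\<lambda>\<omega>. passage_time d (\<lambda>e. \<tau> e \<omega>) x y) \<in> borel_measurable M" for x y
    unfolding passage_time_def
    by (intro borel_measurable_cINF_real countable_paths T)
  have emp_eq: "emp t p B = (\<Sum>i<length p - 1. indicator B (t {p ! i, p ! Suc i})) / real (length p - 1)"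
    for t p
  proof -
    have "{i. Suc i < length p \<and> t {p ! i, p ! Suc i} \<in> B} =
        {i \<in> {..<length p - 1}. t {p ! i, p ! Suc i} \<in> B}"
      by auto
    then have "real (card {i. Suc i < length p \<and> t {p ! i, p ! Suc i} \<in> B}) =
        (\<Sum>i<length p - 1. indicator B (t {p ! i, p ! Suc i}))"
      by (simp add: indicator_def sum.If_cases Int_def)
    then show ?thesis
      by (simp add: emp_def)
  qed
  have [measurable]: "(\<lambda>\<omega>. emp (\<lambda>e. \<tau> e \<omega>) p B) \<in> borel_measurable M" if "p \<in> paths d x y" for p x y
    unfolding emp_eq
  proof (intro borel_measurable_divide borel_measurable_sum)
    fix i assume "i \<in> {..<length p - 1}"
    then have [measurable]: "\<tau> {p ! i, p ! Suc i} \<in> borel_measurable M"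
      using that by (intro assms path_edge_in_edges) (auto simp: paths_def)
    show "(\<lambda>\<omega>. indicator B (\<tau> {p ! i, p ! Suc i} \<omega>) :: real) \<in> borel_measurable M"
      by measurable
  qed auto
  \<comment> \<open>The set of geodesics varies with the weights. Ranging over the fixed countable
    set of all paths, with value \<open>-\<infinity>\<close> at the non-geodesics, leaves the
    supremum unchanged, even when there is no geodesic, and makes it a countable one.\<close>
  have Z_eq: "Zsup d t N B = (SUP x\<in>{x \<in> lattice d. int N \<le> l1 d x}. SUP p\<in>paths d origin x.
      if path_T t p = passage_time d t origin x then ereal (emp t p B) else -\<infinity>)" for t
    unfolding Zsup_def
  proof (rule SUP_cong[OF refl], rule antisym; rule SUP_least)
    fix x p assume "p \<in> geodesics d t origin x"
    then show "ereal (emp t p B) \<le> (SUP p\<in>paths d origin x.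
        if path_T t p = passage_time d t origin x then ereal (emp t p B) else -\<infinity>)"
      by (intro SUP_upper2[of p]) (auto simp: geodesics_def)
  next
    fix x p assume "p \<in> paths d origin x"
    then show "(if path_T t p = passage_time d t origin x then ereal (emp t p B) else -\<infinity>)
        \<le> (SUP p\<in>geodesics d t origin x. ereal (emp t p B))"
      by (auto intro!: SUP_upper simp: geodesics_def)
  qed
  show ?thesis
    unfolding Z_eq
  proof (intro borel_measurable_SUP)
    show "countable {x \<in> lattice d. int N \<le> l1 d x}"
      by (rule countable_subset[OF _ countable_lattice]) auto
  next
    fix x p assume [measurable]: "p \<in> paths d origin x"
    show "(\<lambda>\<omega>. if path_T (\<lambda>e. \<tau> e \<omega>) p = passage_time d (\<lambda>e. \<tau> e \<omega>) origin x
        then ereal (emp (\<lambda>e. \<tau> e \<omega>) p B) else -\<infinity>) \<in> borel_measurable M"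
      by measurable
  qed (rule countable_paths)
qed

section \<open>Chernoff bound and union bound over coarse walks\<close>

text \<open>Chernoff bound with exponential parameter 1: Markov's inequality for the exponential of
  the count, then \<open>1 + (e - 1) p \<le> exp (2 p)\<close> for each factor.\<close>

lemma (in prob_space) prob_count_ge_le:
  fixes X :: "'i \<Rightarrow> 'a \<Rightarrow> real"
  assumes indep: "indep_vars (\<lambda>_. borel) X I" and fin: "finite I" and B [measurable]: "B \<in> sets borel"
    and p: "\<And>i. i \<in> I \<Longrightarrow> prob (X i -` B \<inter> space M) = p"
  shows "prob {\<omega> \<in> space M. a \<le> real (card {i \<in> I. X i \<omega> \<in> B})} \<le> exp (2 * p * card I - a)"
proof (cases "I = {}")
  case True
  then show ?thesis
    using prob_le_1 by (cases "a \<le> 0") (auto intro: order_trans[OF prob_le_1])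
next
  case False
  \<comment> \<open>Nonnegativity of \<open>p\<close> is read off from an actual index, so the empty
    index set had to be treated separately.\<close>
  then have p0: "0 \<le> p" using p measure_nonneg by (metis ex_in_conv)
  \<comment> \<open>\<open>Y i\<close> is the exponential of the indicator of a hit, written as an
    affine function of it so that its expectation is immediate.\<close>
  define Y :: "'i \<Rightarrow> 'a \<Rightarrow> real" where "Y i \<omega> = 1 + (exp 1 - 1) * indicator B (X i \<omega>)" for i \<omega>
  have [measurable]: "X i \<in> borel_measurable M" if "i \<in> I" for i
    using indep that by (auto simp: indep_vars_def)
  have iY: "integrable M (Y i)" and eY: "expectation (Y i) = 1 + (exp 1 - 1) * p" if "i \<in> I" for i
  proof -
    have [simp]: "integrable M (\<lambda>\<omega>. indicator B (X i \<omega>) :: real)"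
      using that by (intro integrable_const_bound[where B = 1]) auto
    show "integrable M (Y i)" unfolding Y_def by simp
    have "expectation (\<lambda>\<omega>. indicator B (X i \<omega>)) = prob (X i -` B \<inter> space M)"
    proof -
      have "expectation (\<lambda>\<omega>. indicator B (X i \<omega>)) =
          expectation (indicator (X i -` B \<inter> space M) :: 'a \<Rightarrow> real)"
        by (intro Bochner_Integration.integral_cong) (auto simp: indicator_def)
      then show ?thesis using that by simp
    qed
    then show "expectation (Y i) = 1 + (exp 1 - 1) * p"
      unfolding Y_def using that by (simp add: prob_space p)
  qed
  have iv: "indep_vars (\<lambda>_. borel) Y I"
    unfolding Y_def using indep by (rule indep_vars_compose2) measurable
  have prod_eq: "(\<Prod>i\<in>I. Y i \<omega>) = exp (real (card {i \<in> I. X i \<omega> \<in> B}))" for \<omega>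
  proof -
    have "(\<Prod>i\<in>I. Y i \<omega>) = (\<Prod>i\<in>I. if X i \<omega> \<in> B then exp 1 else 1)"
      by (intro prod.cong) (auto simp: Y_def)
    also have "\<dots> = exp 1 ^ card {i \<in> I. X i \<omega> \<in> B}"
      using fin by (simp add: prod.If_cases Int_def)
    finally show ?thesis by (simp flip: exp_of_nat_mult)
  qed
  have "prob {\<omega> \<in> space M. a \<le> real (card {i \<in> I. X i \<omega> \<in> B})}
      = prob {\<omega> \<in> space M. exp a \<le> (\<Prod>i\<in>I. Y i \<omega>)}"
    by (simp add: prod_eq)
  also have "\<dots> \<le> expectation (\<lambda>\<omega>. \<Prod>i\<in>I. Y i \<omega>) / exp a"
    using indep_vars_integrable[OF fin iv iY]
    by (intro integral_Markov_inequality_measure[where A = "{}"]) (auto simp: prod_eq)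
  also have "expectation (\<lambda>\<omega>. \<Prod>i\<in>I. Y i \<omega>) = (1 + (exp 1 - 1) * p) ^ card I"
    using indep_vars_lebesgue_integral[OF fin iv iY] by (simp add: eY)
  also have "\<dots> \<le> exp (2 * p) ^ card I"
  proof (rule power_mono)
    have "(exp 1 - 1) * p \<le> 2 * p"
      using exp_le p0 by (intro mult_right_mono) auto
    then show "1 + (exp 1 - 1) * p \<le> exp (2 * p)"
      using exp_ge_add_one_self[of "2 * p"] by linarith
    show "0 \<le> 1 + (exp 1 - 1) * p"
      using p0 by (intro add_nonneg_nonneg mult_nonneg_nonneg) auto
  qed
  finally show ?thesis
    by (simp add: exp_diff divide_right_mono mult.commute flip: exp_of_nat_mult)
qed

text \<open>There are \<open>(3 ^ d) ^ r\<close> coarse walks, and along each the mean number of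
  hits is at most \<open>18 ^ d\<close> times \<open>r + 1\<close>; the Chernoff bound absorbs both
  at a cost linear in \<open>n * q\<close>. The event for paths is enclosed in a finite union of
  measurable events, so its own measurability is not at issue.\<close>

lemma (in prob_space) prob_path_hits_le:
  fixes \<tau> :: "edge \<Rightarrow> 'a \<Rightarrow> real"
  assumes indep: "indep_vars (\<lambda>_. borel) \<tau> (edges d)" and B: "B \<in> sets borel"
    and p: "\<And>e. e \<in> edges d \<Longrightarrow> prob (\<tau> e -` B \<inter> space M) = p"
    and q: "0 < q" "q \<le> 1" "q ^ d = p"
  obtains A where "A \<in> events"
    "{\<omega> \<in> space M. \<exists>P. is_path d P \<and> hd P = origin \<and> length P - 1 = n \<and>
       a \<le> real (card {i. Suc i < length P \<and> \<tau> {P ! i, P ! Suc i} \<omega> \<in> B})} \<subseteq> A"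
    "prob A \<le> exp (2 * 18 ^ d) * exp (real n * q * (2 * 18 ^ d + 2 * real d) - a)"
proof -
  \<comment> \<open>Rounding up gives \<open>l \<ge> 1 / q\<close>, hence at most
    \<open>n * q\<close> coarse steps; \<open>q \<le> 1\<close> gives \<open>l \<le> 2 / q\<close>,
    hence \<open>p * l ^ d \<le> 2 ^ d\<close>.\<close>
  define l where "l = nat \<lceil>1 / q\<rceil>"
  define r where "r = n div l"
  define S where "S = {zs. set zs \<subseteq> lattice_box d (\<lambda>_. -1) 3 \<and> length zs = r}"
  define E where "E zs = incident d (coarse_region d l zs)" for zs
  define G where "G zs = {\<omega> \<in> space M. a \<le> real (card {e \<in> E zs. \<tau> e \<omega> \<in> B})}" for zs
  have "1 \<le> 1 / q" using q by simp
  then have l: "1 / q \<le> real l" "real l \<le> 2 / q" "0 < l"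
    unfolding l_def by linarith+
  have rq: "real r \<le> real n * q"
  proof -
    have "real r \<le> real n / real l"
      unfolding r_def by (rule of_nat_div_le_of_nat)
    also have "\<dots> \<le> real n / (1 / q)"
      using l q by (intro divide_left_mono) auto
    finally show ?thesis by simp
  qed
  have p0: "0 \<le> p" using q by auto
  have pl: "p * real l ^ d \<le> 2 ^ d"
  proof -
    have "p * real l ^ d = (q * real l) ^ d"
      using q by (simp add: power_mult_distrib)
    also have "\<dots> \<le> 2 ^ d"
      using q l by (intro power_mono) (auto simp: field_simps)
    finally show ?thesis .
  qed
  have finE: "finite (E zs)" for zs
    unfolding E_def by (intro finite_incident finite_coarse_region)
  have E_sub: "E zs \<subseteq> edges d" for zs
    by (auto simp: E_def incident_def)
  have meas: "\<tau> e \<in> borel_measurable M" if "e \<in> edges d" for e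
    using indep that by (auto simp: indep_vars_def)
  have G_sets: "G zs \<in> events" for zs
  proof -
    have "real (card {e \<in> E zs. \<tau> e \<omega> \<in> B}) = (\<Sum>e\<in>E zs. indicator B (\<tau> e \<omega>))" for \<omega>
      using finE by (simp add: indicator_def sum.If_cases Int_def)
    moreover have "(\<lambda>\<omega>. indicator B (\<tau> e \<omega>) :: real) \<in> borel_measurable M" if "e \<in> E zs" for e
      using that E_sub[of zs] B
      by (intro measurable_compose[OF meas borel_measurable_indicator]) auto
    ultimately show ?thesis
      unfolding G_def by simp
  qed
  \<comment> \<open>The factor \<open>18 ^ d\<close> collects \<open>2 ^ d\<close> from rounding
    \<open>l\<close>, \<open>3 ^ d\<close> from enlarging the cubes and \<open>3 ^ d\<close> from
    edges per vertex.\<close>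
  have G_prob: "prob (G zs) \<le> exp (2 * 18 ^ d * (real r + 1) - a)" if "zs \<in> S" for zs
  proof -
    have "card (E zs) \<le> card (coarse_region d l zs) * 3 ^ d"
      unfolding E_def by (intro card_incident_le finite_coarse_region)
    also have "\<dots> \<le> ((r + 1) * (3 * l) ^ d) * 3 ^ d"
      using card_coarse_region_le[of d l zs] that by (intro mult_right_mono) (auto simp: S_def)
    also have "\<dots> = (r + 1) * 9 ^ d * l ^ d"
      using power_mult_distrib[of "3 :: nat" 3 d] by (simp add: power_mult_distrib algebra_simps)
    finally have "real (card (E zs)) \<le> real ((r + 1) * 9 ^ d * l ^ d)"
      by (rule of_nat_mono)
    then have "p * real (card (E zs)) \<le> p * ((real r + 1) * 9 ^ d * real l ^ d)"
      using p0 by (intro mult_left_mono) (auto simp: algebra_simps)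
    also have "\<dots> = (p * real l ^ d) * ((real r + 1) * 9 ^ d)"
      by simp
    also have "\<dots> \<le> 2 ^ d * ((real r + 1) * 9 ^ d)"
      using pl by (intro mult_right_mono) auto
    also have "\<dots> = 18 ^ d * (real r + 1)"
      using power_mult_distrib[of "2 :: real" 9 d] by simp
    finally have *: "p * real (card (E zs)) \<le> 18 ^ d * (real r + 1)" .
    have "prob (G zs) \<le> exp (2 * p * card (E zs) - a)"
      unfolding G_def using E_sub p
      by (intro prob_count_ge_le indep_vars_subset[OF indep] finE B) auto
    also have "\<dots> \<le> exp (2 * 18 ^ d * (real r + 1) - a)"
      using * by simp
    finally show ?thesis .
  qed
  have finS: "finite S" and cardS: "card S = (3 ^ d) ^ r"
    unfolding S_def by (simp_all add: finite_lists_length_eq card_lists_length_eq finite_lattice_box card_lattice_box)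
  show thesis
  proof (rule that)
    show "(\<Union>zs\<in>S. G zs) \<in> events"
      using finS G_sets by auto
    show "{\<omega> \<in> space M. \<exists>P. is_path d P \<and> hd P = origin \<and> length P - 1 = n \<and>
       a \<le> real (card {i. Suc i < length P \<and> \<tau> {P ! i, P ! Suc i} \<omega> \<in> B})} \<subseteq> (\<Union>zs\<in>S. G zs)"
    proof safe
      fix \<omega> P
      assume \<omega>: "\<omega> \<in> space M" and P: "is_path d P" "hd P = origin" and n: "n = length P - 1"
        and a: "a \<le> real (card {i. Suc i < length P \<and> \<tau> {P ! i, P ! Suc i} \<omega> \<in> B})"
      obtain zs where zs: "set zs \<subseteq> lattice_box d (\<lambda>_. -1) 3" "length zs = (length P - 1) div l"
        "set P \<subseteq> coarse_region d l zs"
        using path_subset_coarse_region[OF P l(3)] .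
      have "card {i. Suc i < length P \<and> \<tau> {P ! i, P ! Suc i} \<omega> \<in> B} \<le> card {e \<in> E zs. \<tau> e \<omega> \<in> B}"
        unfolding E_def
        by (rule card_path_hits_le[OF P(1) zs(3) finite_coarse_region, of "\<lambda>e. \<tau> e \<omega>"])
      then have "\<omega> \<in> G zs"
        using a \<omega> by (simp add: G_def)
      moreover have "zs \<in> S"
        using zs by (simp add: S_def r_def n)
      ultimately show "\<omega> \<in> (\<Union>zs\<in>S. G zs)" by blast
    qed
    have "prob (\<Union>zs\<in>S. G zs) \<le> (\<Sum>zs\<in>S. prob (G zs))"
      using finS G_sets by (intro finite_measure_subadditive_finite) auto
    also have "\<dots> \<le> (\<Sum>zs\<in>S. exp (2 * 18 ^ d * (real r + 1) - a))"
      by (intro sum_mono G_prob)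
    also have "\<dots> = 3 ^ (d * r) * exp (2 * 18 ^ d * (real r + 1) - a)"
      by (simp add: cardS power_mult)
    \<comment> \<open>Since \<open>3 \<le> exp 2\<close>, the number of walks contributes
      \<open>2 * d * r\<close> to the exponent; the extra 1 in \<open>r + 1\<close> becomes the
      prefactor.\<close>
    also have "\<dots> \<le> exp 2 ^ (d * r) * exp (2 * 18 ^ d * (real r + 1) - a)"
      using exp_ge_add_one_self[of "2 :: real"] by (intro mult_right_mono power_mono) auto
    also have "\<dots> = exp (2 * 18 ^ d) * exp (real r * (2 * 18 ^ d + 2 * real d) - a)"
      by (simp add: algebra_simps flip: exp_of_nat_mult exp_add)
    also have "\<dots> \<le> exp (2 * 18 ^ d) * exp (real n * q * (2 * 18 ^ d + 2 * real d) - a)"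
      using rq by (auto intro!: mult_right_mono add_nonneg_nonneg)
    finally show "prob (\<Union>zs\<in>S. G zs) \<le> \<dots>" .
  qed
qed

section \<open>Exponential tail of the supremum\<close>

text \<open>The threshold for \<open>s\<close> is twice the rate in
  \<open>prob_path_hits_le\<close>, so half of the exponent \<open>s * q * n\<close> survives and
  the bounds for lengths \<open>n \<ge> N\<close> form a geometric series. The condition on
  \<open>N\<close> compensates the factor \<open>1 / (1 - x)\<close>, which blows up as
  \<open>q\<close> tends to 0, and does not involve \<open>s\<close>.\<close>

lemma (in prob_space) prob_Zsup_gt_le:
  fixes \<tau> :: "edge \<Rightarrow> 'a \<Rightarrow> real"
  assumes indep: "indep_vars (\<lambda>_. borel) \<tau> (edges d)" and B: "B \<in> sets borel"
    and p: "\<And>e. e \<in> edges d \<Longrightarrow> prob (\<tau> e -` B \<inter> space M) = p"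
    and q: "0 < q" "q \<le> 1" "q ^ d = p"
    and N: "exp (1 - real N * q / 2) \<le> 1 - exp (- q / 2)"
    and s: "4 * 18 ^ d + 4 * real d \<le> s"
  shows "prob {\<omega> \<in> space M. Zsup d (\<lambda>e. \<tau> e \<omega>) N B > ereal (s * q)} \<le> exp (2 * 18 ^ d) * exp (- s)"
proof -
  define K where "K = exp (2 * 18 ^ d :: real)"
  define x where "x = exp (- (q * s / 2))"
  define H where "H n = {\<omega> \<in> space M. \<exists>P. is_path d P \<and> hd P = origin \<and> length P - 1 = n \<and>
       s * q * real n \<le> real (card {i. Suc i < length P \<and> \<tau> {P ! i, P ! Suc i} \<omega> \<in> B})}" for n
  have "(1 :: real) \<le> 18 ^ d" by (rule one_le_power) simp
  with s have s1: "1 \<le> s" by linarith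
  have "1 - exp (- q / 2) < 1" by simp
  with N have "exp (1 - real N * q / 2) < 1" by linarith
  then have Nq: "1 - real N * q / 2 < 0" by simp
  \<comment> \<open>Positive length rules out the one-vertex path, so \<open>emp\<close> is a
    genuine quotient below.\<close>
  then have N0: "0 < N" by (cases N) auto
  have x: "0 < x" "x < 1"
    using q s1 by (auto simp: x_def)
  have "\<exists>A. A \<in> events \<and> H n \<subseteq> A \<and> prob A \<le> K * x ^ n" for n
  proof -
    obtain A where A: "A \<in> events" "H n \<subseteq> A"
      "prob A \<le> K * exp (real n * q * (2 * 18 ^ d + 2 * real d) - s * q * real n)"
      unfolding H_def K_def
      by (rule prob_path_hits_le[OF indep B p q, where n = n and a = "s * q * real n"])
    have "real n * q * (2 * 18 ^ d + 2 * real d) \<le> real n * q * (s / 2)"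
      using q s by (intro mult_left_mono) auto
    then have "exp (real n * q * (2 * 18 ^ d + 2 * real d) - s * q * real n) \<le> exp (real n * (- (q * s / 2)))"
      by (simp add: algebra_simps)
    also have "\<dots> = x ^ n"
      unfolding x_def by (rule exp_of_nat_mult)
    finally have "K * exp (real n * q * (2 * 18 ^ d + 2 * real d) - s * q * real n) \<le> K * x ^ n"
      by (simp add: K_def)
    with A show ?thesis by fastforce
  qed
  then obtain A where A: "\<And>n. A n \<in> events" "\<And>n. H n \<subseteq> A n" "\<And>n. prob (A n) \<le> K * x ^ n"
    by metis
  have A_le: "prob (A (n + N)) \<le> K * x ^ N * x ^ n" for n
    using A(3)[of "n + N"] by (simp add: power_add mult_ac)
  have geom: "summable (\<lambda>n. K * x ^ N * x ^ n)"
    using x by (intro summable_mult summable_geometric) auto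
  have summ: "summable (\<lambda>n. prob (A (n + N)))"
    using A_le by (intro summable_comparison_test'[OF geom, of 0]) auto
  have "{\<omega> \<in> space M. Zsup d (\<lambda>e. \<tau> e \<omega>) N B > ereal (s * q)} \<subseteq> (\<Union>n. A (n + N))"
  proof safe
    fix \<omega> assume \<omega>: "\<omega> \<in> space M" and "Zsup d (\<lambda>e. \<tau> e \<omega>) N B > ereal (s * q)"
    then obtain y P where y: "int N \<le> l1 d y" and P: "P \<in> geodesics d (\<lambda>e. \<tau> e \<omega>) origin y"
      and gt: "s * q < emp (\<lambda>e. \<tau> e \<omega>) P B"
      by (auto simp: Zsup_def less_SUP_iff)
    have path: "P \<in> paths d origin y" using P by (simp add: geodesics_def)
    have len: "N \<le> length P - 1"
      using l1_le_path_length[OF path] y by linarith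
    have "s * q * real (length P - 1) \<le> real (card {i. Suc i < length P \<and> \<tau> {P ! i, P ! Suc i} \<omega> \<in> B})"
      using gt len N0 by (simp add: emp_def pos_less_divide_eq)
    then have "\<omega> \<in> H (length P - 1)"
      using path \<omega> by (auto simp: H_def paths_def)
    then have "\<omega> \<in> A ((length P - 1 - N) + N)"
      unfolding le_add_diff_inverse2[OF len] using A(2) by blast
    then show "\<omega> \<in> (\<Union>n. A (n + N))" by blast
  qed
  then have "prob {\<omega> \<in> space M. Zsup d (\<lambda>e. \<tau> e \<omega>) N B > ereal (s * q)} \<le> prob (\<Union>n. A (n + N))"
    using A(1) by (intro finite_measure_mono) auto
  also have "prob (\<Union>n. A (n + N)) \<le> (\<Sum>n. prob (A (n + N)))"
    using A(1) summ by (intro finite_measure_subadditive_countably) auto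
  also have "\<dots> \<le> (\<Sum>n. K * x ^ N * x ^ n)"
    by (intro suminf_le A_le summ geom)
  also have "\<dots> = K * x ^ N / (1 - x)"
    using x by (subst suminf_mult) (auto simp: suminf_geometric summable_geometric)
  also have "\<dots> \<le> K * exp (- s)"
  proof -
    have "x ^ N = exp (- s + s * (1 - real N * q / 2))"
      unfolding x_def by (simp add: algebra_simps flip: exp_of_nat_mult)
    \<comment> \<open>The bracket is negative and \<open>s \<ge> 1\<close>, so dropping the factor
      \<open>s\<close> only increases the exponent; this frees the requirement on \<open>N\<close>
      from \<open>s\<close>.\<close>
    also have "\<dots> \<le> exp (- s + 1 * (1 - real N * q / 2))"
      using s1 Nq by (simp only: exp_le_cancel_iff) (intro add_left_mono mult_right_mono_neg, auto)
    also have "\<dots> = exp (- s) * exp (1 - real N * q / 2)"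
      by (simp flip: exp_add)
    also have "\<dots> \<le> exp (- s) * (1 - exp (- q / 2))"
      using N by simp
    also have "\<dots> \<le> exp (- s) * (1 - x)"
      using q s1 by (simp add: x_def)
    finally have "K * x ^ N \<le> K * (exp (- s) * (1 - x))"
      by (intro mult_left_mono) (auto simp: K_def)
    then show ?thesis
      using x by (simp add: pos_divide_le_eq mult.assoc)
  qed
  finally show ?thesis by (simp add: K_def)
qed

section \<open>From the tail to the expectation\<close>

text \<open>A discrete layer-cake bound: beyond \<open>K * q\<close>, each level of width
  \<open>q\<close> that \<open>z\<close> exceeds adds \<open>q\<close>.\<close>

lemma le_step_sum:
  fixes z q :: real
  assumes "0 \<le> q" "z \<le> (K + real m) * q"
  shows "z \<le> K * q + (\<Sum>k<m. q * of_bool (z > (K + real k) * q))"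
  using assms(2)
proof (induction m)
  case 0
  then show ?case by simp
next
  case (Suc m)
  show ?case
  proof (cases "z \<le> (K + real m) * q")
    case True
    with Suc.IH show ?thesis by (simp add: assms(1) add_increasing2)
  next
    case False
    have "z > (K + real k) * q" if "k < Suc m" for k
    proof -
      have "(K + real k) * q \<le> (K + real m) * q"
        using that assms(1) by (intro mult_right_mono) auto
      with False show ?thesis by linarith
    qed
    then have "(\<Sum>k<Suc m. q * of_bool (z > (K + real k) * q)) = (\<Sum>k<Suc m. q)"
      by (intro sum.cong) auto
    with Suc.prems show ?thesis by (simp add: algebra_simps)
  qed
qed

text \<open>Integrating the layer-cake bound with levels of width \<open>q\<close> gives
  \<open>q\<close> times a convergent geometric series, hence a bound proportional to
  \<open>q\<close>. As \<open>Z \<le> 1\<close>, about \<open>1 / q\<close> levels suffice and the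
  sum is finite.\<close>

lemma (in prob_space) nn_integral_le_of_exp_tail:
  fixes Z :: "'a \<Rightarrow> ereal"
  assumes [measurable]: "Z \<in> borel_measurable M" and Z1: "\<And>\<omega>. Z \<omega> \<le> 1"
    and q: "0 < q" and c: "0 \<le> c" and C: "0 \<le> C"
    and tail: "\<And>s. s > c \<Longrightarrow> prob {\<omega> \<in> space M. Z \<omega> > ereal (s * q)} \<le> C * exp (- s)"
  shows "(\<integral>\<^sup>+ \<omega>. e2ennreal (Z \<omega>) \<partial>M) \<le> ennreal ((c + 1 + C / (1 - exp (- 1))) * q)"
proof -
  \<comment> \<open>\<open>Z\<close> is \<open>-\<infinity>\<close> where no geodesic exists;
    truncation at 0 agrees with \<open>e2ennreal\<close> and gives a real-valued function.\<close>
  define z where "z \<omega> = real_of_ereal (max 0 (Z \<omega>))" for \<omega>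
  define m where "m = nat \<lceil>1 / q\<rceil>"
  \<comment> \<open>The levels start at \<open>c + 1\<close> because the tail bound is available
    only for \<open>s\<close> strictly above \<open>c\<close>.\<close>
  define U where "U k = {\<omega> \<in> space M. Z \<omega> > ereal ((c + 1 + real k) * q)}" for k
  have Uk [measurable]: "U k \<in> events" for k
    unfolding U_def by measurable
  have z: "e2ennreal (Z \<omega>) = ennreal (z \<omega>)" "z \<omega> \<le> 1" for \<omega>
    using Z1[of \<omega>] by (cases "Z \<omega>"; auto simp: z_def max_def e2ennreal_neg ennreal_neg one_ereal_def zero_ereal_def)+
  have z_gt: "Z \<omega> > ereal t" if "z \<omega> > t" "0 \<le> t" for \<omega> t
    using Z1[of \<omega>] that by (cases "Z \<omega>") (auto simp: z_def max_def zero_ereal_def split: if_splits)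
  have "1 / q \<le> real m" unfolding m_def by linarith
  then have mq: "1 \<le> real m * q" using q by (simp add: field_simps)
  have le: "z \<omega> \<le> (c + 1) * q + (\<Sum>k<m. q * indicator (U k) \<omega>)" if "\<omega> \<in> space M" for \<omega>
  proof -
    have "0 \<le> (c + 1) * q" using c q by simp
    then have "z \<omega> \<le> (c + 1 + real m) * q"
      using mq z(2)[of \<omega>] by (simp add: algebra_simps)
    then have "z \<omega> \<le> (c + 1) * q + (\<Sum>k<m. q * of_bool (z \<omega> > (c + 1 + real k) * q))"
      using q by (intro le_step_sum) auto
    also have "\<dots> \<le> (c + 1) * q + (\<Sum>k<m. q * indicator (U k) \<omega>)"
    proof (intro add_left_mono sum_mono mult_left_mono)
      fix k
      have "0 \<le> (c + 1 + real k) * q" using c q by simp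
      then show "of_bool (z \<omega> > (c + 1 + real k) * q) \<le> (indicator (U k) \<omega> :: real)"
        using z_gt[of "(c + 1 + real k) * q" \<omega>] that by (auto simp: U_def)
    qed (use q in simp)
    finally show ?thesis .
  qed
  have int_U: "integrable M (\<lambda>\<omega>. q * indicator (U k) \<omega>)" for k
    by (intro integrable_mult_right integrable_real_indicator) (auto simp: less_top[symmetric])
  have int_sum: "integrable M (\<lambda>\<omega>. \<Sum>k<m. q * indicator (U k) \<omega>)"
    by (intro Bochner_Integration.integrable_sum int_U)
  have int: "integrable M (\<lambda>\<omega>. (c + 1) * q + (\<Sum>k<m. q * indicator (U k) \<omega>))"
    by (intro Bochner_Integration.integrable_add int_sum) simp
  have "(\<integral>\<^sup>+ \<omega>. e2ennreal (Z \<omega>) \<partial>M) \<le>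
      (\<integral>\<^sup>+ \<omega>. ennreal ((c + 1) * q + (\<Sum>k<m. q * indicator (U k) \<omega>)) \<partial>M)"
    unfolding z(1) by (intro nn_integral_mono ennreal_leI le)
  also have "\<dots> = ennreal (\<integral>\<omega>. (c + 1) * q + (\<Sum>k<m. q * indicator (U k) \<omega>) \<partial>M)"
    using int q c by (intro nn_integral_eq_integral) (auto intro!: add_nonneg_nonneg sum_nonneg)
  also have "(\<integral>\<omega>. (c + 1) * q + (\<Sum>k<m. q * indicator (U k) \<omega>) \<partial>M)
      = (c + 1) * q + (\<Sum>k<m. q * prob (U k))"
    unfolding Bochner_Integration.integral_add[OF integrable_const int_sum]
      Bochner_Integration.integral_sum[OF int_U]
    by (simp add: prob_space)
  also have "\<dots> \<le> (c + 1 + C / (1 - exp (- 1))) * q"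
  proof -
    have "prob (U k) \<le> C * exp (- 1) ^ k" for k
    proof -
      have "prob (U k) \<le> C * exp (- (c + 1 + real k))"
        unfolding U_def by (rule tail) simp
      also have "\<dots> \<le> C * exp (real k * (- 1))"
        using c C by (intro mult_left_mono) auto
      finally show ?thesis by (simp only: exp_of_nat_mult)
    qed
    then have "(\<Sum>k<m. prob (U k)) \<le> (\<Sum>k<m. C * exp (- 1) ^ k)"
      by (rule sum_mono)
    also have "\<dots> \<le> (\<Sum>k. C * exp (- 1) ^ k)"
      using C by (intro sum_le_suminf summable_mult summable_geometric) auto
    also have "\<dots> = C / (1 - exp (- 1))"
      by (subst suminf_mult) (auto simp: suminf_geometric summable_geometric)
    finally have "q * (\<Sum>k<m. prob (U k)) \<le> q * (C / (1 - exp (- 1)))"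
      using q by (intro mult_left_mono) auto
    then show ?thesis
      by (simp add: algebra_simps flip: sum_distrib_left)
  qed
  finally show ?thesis
    by (simp add: ennreal_leI)
qed

section \<open>Choice of constants and conclusion\<close>

lemma ex_nat_exp_le:
  fixes q b :: real
  assumes "0 < q" "0 < b"
  shows "\<exists>N :: nat. exp (1 - real N * q / 2) \<le> b"
proof -
  obtain N :: nat where "(1 - ln b) * 2 / q \<le> real N"
    using real_arch_simple by blast
  then have "1 - real N * q / 2 \<le> ln b"
    using assms by (simp add: field_simps)
  then have "exp (1 - real N * q / 2) \<le> exp (ln b)"
    by (simp only: exp_le_cancel_iff)
  then show ?thesis using assms by auto
qed

theorem theorem2p4:
  fixes d :: nat and \<mu> :: "real measure"
  assumes "d \<ge> 2"
    and "prob_space \<mu>" and "sets \<mu> = sets borel" and "measure \<mu> {..<0} = 0"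
    and "ess_inf_law \<mu> = 0 \<longrightarrow> cdf \<mu> (ess_inf_law \<mu>) < p_c d"
    and "ess_inf_law \<mu> > 0 \<longrightarrow> cdf \<mu> (ess_inf_law \<mu>) < vp_c d"
  shows "\<exists>C7 C8 C9 C3'. C7 > 0 \<and> C8 > 0 \<and> C9 > 0 \<and> C3' > 0 \<and>
    (\<forall>(M :: 'a measure) (\<tau> :: edge \<Rightarrow> 'a \<Rightarrow> real).
       prob_space M \<and>
       (\<forall>e\<in>edges d. \<forall>\<omega>\<in>space M. \<tau> e \<omega> \<ge> 0) \<and>
       (\<forall>e\<in>edges d. distr M borel (\<tau> e) = \<mu>) \<and>
       prob_space.indep_vars M (\<lambda>_. borel) \<tau> (edges d)
     \<longrightarrow>
       (\<forall>B \<in> sets borel. measure \<mu> B > 0 \<longrightarrow>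
          (\<exists>N :: nat.
             (\<lambda>\<omega>. Zsup d (\<lambda>e. \<tau> e \<omega>) N B) \<in> borel_measurable M \<and>
             (\<forall>s > C7.
                measure M {\<omega> \<in> space M. Zsup d (\<lambda>e. \<tau> e \<omega>) N B
                                         > ereal (s * measure \<mu> B powr (1 / real d))}
                  \<le> C8 * exp (- C9 * s)) \<and>
             (\<integral>\<^sup>+ \<omega>. e2ennreal (Zsup d (\<lambda>e. \<tau> e \<omega>) N B) \<partial>M)
                  \<le> ennreal (C3' * measure \<mu> B powr (1 / real d)))))"
proof -
  \<comment> \<open>All constants depend on \<open>d\<close> alone: \<open>C7\<close> is the
    threshold and \<open>C8\<close> the prefactor of \<open>prob_Zsup_gt_le\<close>, the decay rate
    is 1, and \<open>C3'\<close> is the factor in \<open>nn_integral_le_of_exp_tail\<close>.\<close>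
  define C7 :: real where "C7 = 4 * 18 ^ d + 4 * real d"
  define C8 :: real where "C8 = exp (2 * 18 ^ d)"
  define C3' where "C3' = C7 + 1 + C8 / (1 - exp (- 1))"
  have pos: "0 < C7" "0 < C8"
    by (auto simp: C7_def C8_def intro!: add_pos_nonneg)
  then have pos3: "0 < C3'"
    by (auto simp: C3'_def intro!: add_pos_pos)
  interpret \<mu>: prob_space \<mu> by fact
  have main: "\<exists>N :: nat.
      (\<lambda>\<omega>. Zsup d (\<lambda>e. \<tau> e \<omega>) N B) \<in> borel_measurable M \<and>
      (\<forall>s > C7. measure M {\<omega> \<in> space M. Zsup d (\<lambda>e. \<tau> e \<omega>) N B
          > ereal (s * measure \<mu> B powr (1 / real d))} \<le> C8 * exp (- 1 * s)) \<and>
      (\<integral>\<^sup>+ \<omega>. e2ennreal (Zsup d (\<lambda>e. \<tau> e \<omega>) N B) \<partial>M)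
          \<le> ennreal (C3' * measure \<mu> B powr (1 / real d))"
    if M: "prob_space M" and law: "\<forall>e\<in>edges d. distr M borel (\<tau> e) = \<mu>"
      and indep: "prob_space.indep_vars M (\<lambda>_. borel) \<tau> (edges d)"
      and B: "B \<in> sets borel" "measure \<mu> B > 0"
    for M :: "'a measure" and \<tau> B
  proof -
    interpret M: prob_space M by fact
    define q where "q = measure \<mu> B powr (1 / real d)"
    have q: "0 < q" "q \<le> 1" "q ^ d = measure \<mu> B"
      using B(2) assms(1) by (auto simp: q_def powr_le1 powr_realpow[symmetric] powr_powr)
    have meas: "\<tau> e \<in> borel_measurable M" if "e \<in> edges d" for e
      using indep that by (auto simp: M.indep_vars_def)
    have p: "M.prob (\<tau> e -` B \<inter> space M) = measure \<mu> B" if "e \<in> edges d" for e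
      using measure_distr[OF meas[OF that] B(1)] law that by simp
    \<comment> \<open>Only \<open>q\<close>, that is the measure of \<open>B\<close>, enters the
      choice of \<open>N\<close>; the target \<open>1 - exp (- q / 2)\<close> is positive since
      \<open>q > 0\<close>.\<close>
    obtain N :: nat where N: "exp (1 - real N * q / 2) \<le> 1 - exp (- q / 2)"
      using ex_nat_exp_le[of q "1 - exp (- q / 2)"] q by auto
    have Zm: "(\<lambda>\<omega>. Zsup d (\<lambda>e. \<tau> e \<omega>) N B) \<in> borel_measurable M"
      using meas B(1) by (rule measurable_Zsup)
    have tail: "M.prob {\<omega> \<in> space M. Zsup d (\<lambda>e. \<tau> e \<omega>) N B > ereal (s * q)} \<le> C8 * exp (- s)"
      if "s > C7" for s
      unfolding C8_def using that
      by (intro M.prob_Zsup_gt_le[OF indep B(1) p q N]) (auto simp: C7_def)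
    have "(\<integral>\<^sup>+ \<omega>. e2ennreal (Zsup d (\<lambda>e. \<tau> e \<omega>) N B) \<partial>M) \<le> ennreal (C3' * q)"
      unfolding C3'_def using pos
      by (intro M.nn_integral_le_of_exp_tail Zm Zsup_le_1 q(1) tail) auto
    with Zm tail show ?thesis
      unfolding q_def by (intro exI[of _ N]) simp
  qed
  show ?thesis
    by (rule exI[of _ C7], rule exI[of _ C8], rule exI[of _ 1], rule exI[of _ C3'])
       (intro conjI allI impI ballI pos pos3 zero_less_one, elim conjE, rule main)
qed

end
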